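(* Let $A[1\cdots n]$ be an array whose entries are independent uniform random real numbers in $[0,1)$. There is an encoding of the 1D range maximum query problem on $A$ that is decodable in time linear in $n$ and that uses, in expectation, $cn+o(n)$ bits, where $c=\tfrac13\log 6+\tfrac23\log 3=1.9183\ldots<1.92$.
   Context: All logarithms are to base 2. For an array $A[1\cdots n]$ with distinct entries, the 1D range maximum query (1D-RMQ) with parameters $1\le j_1\le j_2\le n$ returns the index in $\{j_1,\dots,j_2\}$ at which $A$ attains its maximum over that range. An encoding of 1D-RMQ maps arrays of known length $n$ to bit strings so that all such queries can be answered from the bit string alone, without access to $A$. The Cartesian tree of $A$ is the unlabeled $n$-node binary tree whose root corresponds to the position $i$ of the maximum of $A$ and whose left and right subtrees are the Cartesian trees of $A[1\cdots i-1]$ and $A[i+1\cdots n]$ (the Cartesian tree of an empty array is the empty tree); it determines the answers to all 1D-RMQ queries. Decodable in linear time means that the Cartesian tree of $A$ can be reconstructed from the encoding in $O(n)$ time (RAM model with word size logarithmic in $n$). *)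

theory Defs
  imports
    "HOL-Probability.Probability"
    "HOL-Library.Tree"
    "HOL-Library.Landau_Symbols"
begin

text \<open>
  An array \<open>A[1..n]\<close> is a function on \<open>nat\<close> that is \<open>undefined\<close> outside \<open>{1..n}\<close>.
\<close>

definition distinct_arrays :: "nat \<Rightarrow> (nat \<Rightarrow> real) set" where
  "distinct_arrays n = {A \<in> extensional {1..n}. inj_on A {1..n}}"

definition rmq :: "(nat \<Rightarrow> real) \<Rightarrow> nat \<Rightarrow> nat \<Rightarrow> nat" where
  "rmq A i j = arg_max_on A {i..j}"

definition rmq_encoding :: "(nat \<Rightarrow> (nat \<Rightarrow> real) \<Rightarrow> bool list) \<Rightarrow> bool" where
  "rmq_encoding enc \<longleftrightarrow>
    (\<exists>query :: nat \<Rightarrow> bool list \<Rightarrow> nat \<Rightarrow> nat \<Rightarrow> nat.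
      \<forall>n. \<forall>A \<in> distinct_arrays n. \<forall>i j. 1 \<le> i \<and> i \<le> j \<and> j \<le> n \<longrightarrow>
        query n (enc n A) i j = rmq A i j)"

lemma is_arg_max_arg_max_on:
  fixes f :: "'a \<Rightarrow> 'b :: linorder"
  assumes "finite S" "S \<noteq> {}"
  shows "is_arg_max f (\<lambda>x. x \<in> S) (arg_max_on f S)"
proof -
  have "Max (f ` S) \<in> f ` S"
    using assms by simp
  then obtain x where x: "x \<in> S" "f x = Max (f ` S)"
    by auto
  hence "is_arg_max f (\<lambda>x. x \<in> S) x"
    using assms by (auto simp: is_arg_max_def not_less)
  thus ?thesis
    unfolding arg_max_on_def arg_max_def by (rule someI)
qed

lemma arg_max_on_in:
  fixes f :: "'a \<Rightarrow> 'b :: linorder"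
  assumes "finite S" "S \<noteq> {}"
  shows "arg_max_on f S \<in> S"
  using is_arg_max_arg_max_on[OF assms, of f] by (simp add: is_arg_max_def)

text \<open>
  The Cartesian tree of the segment \<open>A[i..j-1]\<close>. The half-open range keeps truncated
  subtraction on \<open>nat\<close> out of the recursion.
\<close>

function cartesian_seg :: "(nat \<Rightarrow> real) \<Rightarrow> nat \<Rightarrow> nat \<Rightarrow> unit tree" where
  "cartesian_seg A i j =
    (if i < j
     then let m = arg_max_on A {i..<j}
          in Node (cartesian_seg A i m) () (cartesian_seg A (m + 1) j)
     else Leaf)"
  by pat_completeness auto

termination
proof (relation "Wellfounded.measure (\<lambda>(A, i, j). j - i)", goal_cases)
  case 1
  show ?case by simp
next
  case (2 A i j m)
  have "m \<in> {i..<j}"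
    using arg_max_on_in[of "{i..<j}" A] 2 by simp
  thus ?case using 2 by auto
next
  case (3 A i j m)
  have "m \<in> {i..<j}"
    using arg_max_on_in[of "{i..<j}" A] 3 by simp
  thus ?case using 3 by auto
qed

declare cartesian_seg.simps [simp del]

definition cartesian_tree :: "nat \<Rightarrow> (nat \<Rightarrow> real) \<Rightarrow> unit tree" where
  "cartesian_tree n A = cartesian_seg A 1 (n + 1)"

text \<open>
  A word RAM. Registers and memory cells hold numbers below \<open>2 ^ w\<close>, memory is addressed by
  register contents, and every instruction takes unit time. The encoding is a read-only bit
  string of which one instruction reads a single bit; this is no more powerful than having
  the bits packed into words, as a bit can be extracted from a word in constant time.
\<close>

datatype binop = Add | Sub | Mul | Div | Mod | BitAnd | BitOr | BitXor | Shl | Shr | Less | Equal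

fun binop_val :: "nat \<Rightarrow> binop \<Rightarrow> nat \<Rightarrow> nat \<Rightarrow> nat" where
  "binop_val w Add x y = take_bit w (x + y)"
| "binop_val w Sub x y = take_bit w (x + 2 ^ w - y)"
| "binop_val w Mul x y = take_bit w (x * y)"
| "binop_val w Div x y = take_bit w (x div y)"
| "binop_val w Mod x y = take_bit w (x mod y)"
| "binop_val w BitAnd x y = take_bit w (Bit_Operations.and x y)"
| "binop_val w BitOr x y = take_bit w (Bit_Operations.or x y)"
| "binop_val w BitXor x y = take_bit w (Bit_Operations.xor x y)"
| "binop_val w Shl x y = take_bit w (push_bit y x)"
| "binop_val w Shr x y = take_bit w (drop_bit y x)"
| "binop_val w Less x y = take_bit w (of_bool (x < y))"
| "binop_val w Equal x y = take_bit w (of_bool (x = y))"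

text \<open>The arguments of an instruction are register numbers, except for the constant
  in \<open>Const\<close> and the jump targets.\<close>

datatype instr =
    Const nat nat
  | Binop binop nat nat nat
  | Load nat nat
  | Store nat nat
  | Input nat nat
  | Jump nat
  | JumpZero nat nat

record ram_state =
  pc :: nat
  reg :: "nat \<Rightarrow> nat"
  mem :: "nat \<Rightarrow> nat"

fun exec :: "nat \<Rightarrow> bool list \<Rightarrow> instr \<Rightarrow> ram_state \<Rightarrow> ram_state" where
  "exec w bs (Const d c) s =
    s\<lparr>pc := pc s + 1, reg := (reg s)(d := take_bit w c)\<rparr>"
| "exec w bs (Binop f d a b) s =
    s\<lparr>pc := pc s + 1, reg := (reg s)(d := binop_val w f (reg s a) (reg s b))\<rparr>"
| "exec w bs (Load d a) s =
    s\<lparr>pc := pc s + 1, reg := (reg s)(d := mem s (reg s a))\<rparr>"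
| "exec w bs (Store a b) s =
    s\<lparr>pc := pc s + 1, mem := (mem s)(reg s a := reg s b)\<rparr>"
| "exec w bs (Input d a) s =
    s\<lparr>pc := pc s + 1,
      reg := (reg s)(d := take_bit w (of_bool (reg s a < length bs \<and> bs ! reg s a)))\<rparr>"
| "exec w bs (Jump l) s = s\<lparr>pc := l\<rparr>"
| "exec w bs (JumpZero a l) s = s\<lparr>pc := (if reg s a = 0 then l else pc s + 1)\<rparr>"

text \<open>A program halts by leaving its instruction list.\<close>

definition halted :: "instr list \<Rightarrow> ram_state \<Rightarrow> bool" where
  "halted prog s \<longleftrightarrow> length prog \<le> pc s"

definition step :: "nat \<Rightarrow> bool list \<Rightarrow> instr list \<Rightarrow> ram_state \<Rightarrow> ram_state" where
  "step w bs prog s = (if halted prog s then s else exec w bs (prog ! pc s) s)"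

text \<open>Initially, registers 0 and 1 hold \<open>n\<close> and the length of the bit string.\<close>

definition init_state :: "nat \<Rightarrow> nat \<Rightarrow> bool list \<Rightarrow> ram_state" where
  "init_state w n bs =
    \<lparr>pc = 0, reg = (\<lambda>_. 0)(0 := take_bit w n, 1 := take_bit w (length bs)), mem = (\<lambda>_. 0)\<rparr>"

text \<open>
  Linked representation of a binary tree: a node at address \<open>p \<noteq> 0\<close> stores the addresses of its
  left and right child in the cells \<open>p\<close> and \<open>p + 1\<close>, and the empty tree has address 0. The cells
  must be pairwise distinct, so that no subtrees are shared.
\<close>

fun linked_tree :: "(nat \<Rightarrow> nat) \<Rightarrow> nat \<Rightarrow> unit tree \<Rightarrow> bool" where
  "linked_tree M p Leaf \<longleftrightarrow> p = 0"
| "linked_tree M p (Node l _ r) \<longleftrightarrow>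
    p \<noteq> 0 \<and> linked_tree M (M p) l \<and> linked_tree M (M (p + 1)) r"

fun tree_cells :: "(nat \<Rightarrow> nat) \<Rightarrow> nat \<Rightarrow> unit tree \<Rightarrow> nat list" where
  "tree_cells M p Leaf = []"
| "tree_cells M p (Node l _ r) =
    p # (p + 1) # tree_cells M (M p) l @ tree_cells M (M (p + 1)) r"

definition stores_tree :: "(nat \<Rightarrow> nat) \<Rightarrow> nat \<Rightarrow> unit tree \<Rightarrow> bool" where
  "stores_tree M p t \<longleftrightarrow> linked_tree M p t \<and> distinct (tree_cells M p t)"

definition word_size :: "nat \<Rightarrow> nat \<Rightarrow> nat" where
  "word_size k n = k * nat \<lceil>log 2 (real n + 2)\<rceil>"

text \<open>
  The program and the constant factor \<open>k\<close> in the word size do not depend on \<open>n\<close>. The address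
  of the root of the output is left in register 0.
\<close>

definition linear_time_decodable :: "(nat \<Rightarrow> (nat \<Rightarrow> real) \<Rightarrow> bool list) \<Rightarrow> bool" where
  "linear_time_decodable enc \<longleftrightarrow>
    (\<exists>(prog :: instr list) (k :: nat) (T :: nat \<Rightarrow> nat).
      (\<lambda>n. real (T n)) \<in> O(\<lambda>n. real n) \<and>
      (\<forall>n. \<forall>A \<in> distinct_arrays n.
        let w = word_size k n;
            s = (step w (enc n A) prog ^^ T n) (init_state w n (enc n A))
        in halted prog s \<and> stores_tree (mem s) (reg s 0) (cartesian_tree n A)))"

definition uniform_array :: "nat \<Rightarrow> (nat \<Rightarrow> real) measure" where
  "uniform_array n = Pi\<^sub>M {1..n} (\<lambda>_. uniform_measure lborel {0..<1})"

definition rmq_const :: real where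
  "rmq_const = 1 / 3 * log 2 6 + 2 / 3 * log 2 3"

end

theory Submission
  imports Defs "HOL-Real_Asymp.Real_Asymp"
begin

text \<open>
  Describe a node of the Cartesian tree by which of its two children exist. The number of children
  is a trit, and a node with exactly one child needs one further bit to tell the side. The
  \<open>n\<close> trits cost \<open>n log 3 + O(log n)\<close> bits when they are stored with an asymmetric numeral system,
  whose state fits into one machine word, so that each trit is decoded in constant time. In
  postorder the tree is rebuilt with a stack of finished subtrees.

  Position \<open>k\<close> has exactly one child iff \<open>A k\<close> lies strictly between its two neighbours. By symmetry
  this has probability \<open>1/3\<close> for every inner position, so the expected length is
  \<open>n log 3 + n/3 + O(log n)\<close>, and \<open>log 3 + 1/3\<close> is the claimed constant.
\<close>

subsection \<open>Coding trits with an asymmetric numeral system\<close>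

text \<open>Low bits are appended at the end, so the list carries the removed bits with the most
  significant one first. A decoder that doubles its state and adds the next bit can thus consume
  them from the front.\<close>

fun shed :: "nat \<Rightarrow> nat \<Rightarrow> nat \<times> bool list" where
  "shed b x =
    (if x \<le> b then (x, []) else let (y, cs) = shed b (x div 2) in (y, cs @ [odd x]))"

declare shed.simps [simp del]

lemma shed_le: "fst (shed b x) \<le> b"
  by (induction b x rule: shed.induct) (subst shed.simps, auto split: prod.splits simp: prod_eq_iff)

text \<open>Halving happens only above \<open>b\<close>, and there
  \<open>2 * a \<le> Suc b \<le> x\<close>, so half of \<open>x\<close> is still at least
  \<open>a\<close>.\<close>

lemma shed_ge:
  assumes "a \<le> x" "2 * a \<le> Suc b"
  shows "a \<le> fst (shed b x)"
  using assms
proof (induction b x rule: shed.induct)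
  case (1 b x)
  then show ?case
    by (cases "x \<le> b") (auto simp: shed.simps[of b x] split: prod.splits)
qed

lemma shed_interval:
  assumes "shed b x = (y, cs)"
  shows "y * 2 ^ length cs \<le> x \<and> x < (y + 1) * 2 ^ length cs"
  using assms
proof (induction b x arbitrary: y cs rule: shed.induct)
  case (1 b x)
  show ?case
  proof (cases "x \<le> b")
    case True
    with 1(2) show ?thesis by (auto simp: shed.simps[of b x])
  next
    case False
    obtain cs' where cs': "shed b (x div 2) = (y, cs')" "cs = cs' @ [odd x]"
      using 1(2) False by (auto simp: shed.simps[of b x] split: prod.splits)
    have "y * 2 ^ length cs' \<le> x div 2" "x div 2 < (y + 1) * 2 ^ length cs'"
      using 1(1)[OF False cs'(1)] by auto
    then have "2 * (y * 2 ^ length cs') \<le> x" "x < 2 * ((y + 1) * 2 ^ length cs')"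
      by linarith+
    then show ?thesis by (simp add: cs'(2) mult_ac)
  qed
qed

text \<open>
  The state stays in \<open>{3n+3..<6n+6}\<close>. Before a trit \<open>d\<close> is absorbed by \<open>y \<mapsto> 3 y + d\<close>, low bits of
  the state are moved to the output until \<open>y \<in> {n+1..2n+1}\<close>. The decoder undoes this from the
  front of the bit string, hence the recursion from the end of the symbol list.
\<close>

fun ans :: "nat \<Rightarrow> (bool \<times> bool) list \<Rightarrow> nat \<times> bool list" where
  "ans n [] = (3 * n + 3, [])"
| "ans n ((l, r) # ss) =
    (let (x, bs) = ans n ss; (y, cs) = shed (2 * n + 1) x
     in (3 * y + of_bool l + of_bool r, (if l \<noteq> r then [r] else []) @ cs @ bs))"

text \<open>The final state is written in binary without its leading 1: \<open>shed 1\<close>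
  reduces a positive number to exactly 1. The decoder accordingly starts in state 1, and no separate
  header is needed.\<close>

definition encode :: "nat \<Rightarrow> (bool \<times> bool) list \<Rightarrow> bool list" where
  "encode n ss = (let (x, bs) = ans n ss in snd (shed 1 x) @ bs)"

lemma ans_range: "3 * n + 3 \<le> fst (ans n ss) \<and> fst (ans n ss) < 6 * n + 6"
proof (induction n ss rule: ans.induct)
  case (2 n l r ss)
  obtain x bs where x: "ans n ss = (x, bs)" by fastforce
  obtain y cs where y: "shed (2 * n + 1) x = (y, cs)" by fastforce
  have "y \<le> 2 * n + 1" using shed_le[of "2 * n + 1" x] y by simp
  moreover have "n + 1 \<le> y" using shed_ge[of "n + 1" x "2 * n + 1"] 2 x y by simp
  ultimately show ?case by (simp add: x y del: One_nat_def add_Suc_right)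
qed simp

section \<open>Length of the code\<close>

lemma log_ratio_bound:
  fixes a b c d :: real
  assumes "0 < a" "0 < c" "0 < d" "0 < m" "a * d \<le> c * (1 + 1 / m)" "c \<le> a * d * (1 + 1 / m)"
  shows "\<bar>log 2 a + log 2 d - log 2 c\<bar> \<le> 2 / m"
proof -
  have m: "0 < 1 + 1 / m" using assms(4) by (simp add: add_pos_pos)
  have "ln (1 + 1 / m) \<le> 1 / m" using assms(4) by (intro ln_add_one_self_le_self) simp
  moreover have "1 / 2 \<le> ln (2 :: real)"
    using ln_le_minus_one[of "1 / 2 :: real"] by (simp add: ln_div)
  then have "1 / m \<le> 2 / m * ln 2"
    using assms(4) by (simp add: field_simps)
  ultimately have 1: "log 2 (1 + 1 / m) \<le> 2 / m"
    by (simp add: log_def pos_divide_le_eq)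
  have "log 2 (a * d) \<le> log 2 (c * (1 + 1 / m))"
    using assms m by (subst log_le_cancel_iff) auto
  moreover have "log 2 c \<le> log 2 (a * d * (1 + 1 / m))"
    using assms m by (subst log_le_cancel_iff) auto
  ultimately show ?thesis
    using 1 assms m by (simp add: log_mult_pos)
qed

text \<open>The logarithm of the state acts as a potential: bits written plus the change of
  potential is \<open>log 2 3\<close> up to rounding. Shedding rounds
  \<open>x / 2 ^ length cs\<close> down to \<open>y\<close>, and adding \<open>d\<close> pushes
  \<open>3 * y\<close> up. Each costs at most a factor \<open>1 + 1 / (n + 1)\<close> because
  \<open>y\<close> is at least \<open>n + 1\<close>, and the two act in opposite directions, so they
  do not compound.\<close>

lemma ans_length_step:
  assumes x: "3 * n + 3 \<le> x" and y: "shed (2 * n + 1) x = (y, cs)" and d: "d \<le> 2"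
  shows "\<bar>real (length cs) + log 2 (real (3 * y + d)) - log 2 (real x) - log 2 3\<bar>
    \<le> 2 / real (n + 1)"
proof -
  define P :: real where "P = 2 ^ length cs"
  have P: "P > 0" by (simp add: P_def)
  have yge: "n + 1 \<le> y" using shed_ge[of "n + 1" x "2 * n + 1"] x y by simp
  have "real (y * 2 ^ length cs) \<le> real x" "real x < real ((y + 1) * 2 ^ length cs)"
    using shed_interval[OF y] by (simp_all only: of_nat_le_iff of_nat_less_iff)
  then have lo: "real y * P \<le> real x" and hi: "real x < (real y + 1) * P"
    by (simp_all add: P_def algebra_simps)
  have yr: "real y / real (n + 1) \<ge> 1" using yge by (simp add: field_simps)
  have a: "real (3 * y + d) \<le> 3 * real y * (1 + 1 / real (n + 1))"
  proof -
    have "real d \<le> 3 * (real y / real (n + 1))" using d yr by linarith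
    then show ?thesis by (simp add: algebra_simps add_divide_distrib)
  qed
  have b: "real y + 1 \<le> real y * (1 + 1 / real (n + 1))"
    using yr by (simp add: algebra_simps)
  have "\<bar>log 2 P + log 2 (real (3 * y + d)) - log 2 (3 * real x)\<bar> \<le> 2 / real (n + 1)"
  proof (rule log_ratio_bound)
    show "0 < P" by (fact P)
    have "P * real (3 * y + d) \<le> P * (3 * real y * (1 + 1 / real (n + 1)))"
      using a P by (intro mult_left_mono) auto
    also have "\<dots> = 3 * (real y * P) * (1 + 1 / real (n + 1))" by simp
    also have "\<dots> \<le> 3 * real x * (1 + 1 / real (n + 1))"
      using lo by (intro mult_right_mono) auto
    finally show "P * real (3 * y + d) \<le> 3 * real x * (1 + 1 / real (n + 1))" .
    have "3 * real x \<le> 3 * ((real y + 1) * P)" using hi by simp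
    also have "\<dots> \<le> 3 * (real y * (1 + 1 / real (n + 1)) * P)"
      using b P by (intro mult_left_mono mult_right_mono) auto
    also have "\<dots> = P * (3 * real y) * (1 + 1 / real (n + 1))" by simp
    also have "\<dots> \<le> P * real (3 * y + d) * (1 + 1 / real (n + 1))"
      using P by (intro mult_right_mono mult_left_mono) auto
    finally show "3 * real x \<le> P * real (3 * y + d) * (1 + 1 / real (n + 1))" .
  qed (use x yge in auto)
  moreover have "log 2 P = real (length cs)" by (simp add: P_def log_nat_power)
  moreover have "log 2 (3 * real x) = log 2 3 + log 2 (real x)"
    using x by (subst log_mult_pos) auto
  ultimately show ?thesis by simp
qed

definition unary :: "bool \<times> bool \<Rightarrow> bool" where
  "unary s \<longleftrightarrow> fst s \<noteq> snd s"

text \<open>The potential differences telescope from the initial state \<open>3 * n + 3\<close>.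
  With a state of order \<open>n\<close>, the rounding errors of \<open>n\<close> symbols add up to
  less than 2.\<close>

lemma ans_length:
  "\<bar>real (length (snd (ans n ss))) + log 2 (real (fst (ans n ss))) - log 2 (real (3 * n + 3))
      - real (length ss) * log 2 3 - real (length (filter unary ss))\<bar>
    \<le> real (length ss) * (2 / real (n + 1))"
proof (induction ss)
  case (Cons s ss)
  obtain l r where s: "s = (l, r)" by fastforce
  obtain x bs where x: "ans n ss = (x, bs)" by fastforce
  obtain y cs where y: "shed (2 * n + 1) x = (y, cs)" by fastforce
  define d :: nat where "d = of_bool l + of_bool r"
  have "3 * n + 3 \<le> x" using ans_range[of n ss] x by simp
  note step = ans_length_step[OF this y, of d]
  have e: "fst (ans n (s # ss)) = 3 * y + d" "length (snd (ans n (s # ss))) =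
      (if unary s then 1 else 0) + length cs + length bs"
    by (auto simp: s x y d_def unary_def simp del: One_nat_def add_Suc_right)
  have d2: "d \<le> 2" by (simp add: d_def)
  define Q where "Q = 2 / real (n + 1)"
  have "real (length (s # ss)) * Q = real (length ss) * Q + Q" by (simp add: algebra_simps)
  moreover have "real (length (s # ss)) * log 2 3 = real (length ss) * log 2 3 + log 2 3"
    by (simp add: algebra_simps)
  ultimately show ?case
    using step[OF d2] Cons.IH
    unfolding e Q_def[symmetric] by (simp add: x) linarith
qed simp

lemma shed_1_length:
  assumes "0 < x"
  shows "real (length (snd (shed 1 x))) \<le> log 2 (real x)"
    and "log 2 (real x) \<le> real (length (snd (shed 1 x))) + 1"
proof -
  obtain y cs where y: "shed 1 x = (y, cs)" by fastforce
  have "y \<le> 1" "1 \<le> y"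
    using shed_le[of 1 x] shed_ge[of 1 x 1] assms y by auto
  then have "y = 1" by simp
  then have "2 ^ length cs \<le> x" "x < 2 ^ (length cs + 1)"
    using shed_interval[OF y] by auto
  then have "real (2 ^ length cs) \<le> real x" "real x < real (2 ^ (length cs + 1))"
    by (simp_all only: of_nat_le_iff of_nat_less_iff)
  then have "2 ^ length cs \<le> real x" "real x < 2 ^ (length cs + 1)"
    by (simp_all only: of_nat_power of_nat_numeral)
  then have "2 powr (real (length cs)) \<le> real x" "real x < 2 powr (real (length cs + 1))"
    by (simp_all only: powr_realpow zero_less_numeral)
  then show "real (length (snd (shed 1 x))) \<le> log 2 (real x)"
    "log 2 (real x) \<le> real (length (snd (shed 1 x))) + 1"
    using assms y by (auto simp: le_log_iff log_le_iff add.commute)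
qed

text \<open>The constant 3 is 2 for the accumulated rounding and 1 for writing out the final state
  in whole bits; the logarithm is the potential of the initial state.\<close>

lemma encode_length:
  assumes "length ss = n"
  shows "\<bar>real (length (encode n ss)) - real n * log 2 3 - real (length (filter unary ss))\<bar>
    \<le> 3 + log 2 (real (3 * n + 3))"
proof -
  obtain x bs where x: "ans n ss = (x, bs)" by fastforce
  have xp: "0 < x" using ans_range[of n ss] x by simp
  have "real n * (2 / real (n + 1)) \<le> 2" by (simp add: field_simps)
  moreover have "0 \<le> log 2 (real (3 * n + 3))" by simp
  moreover have "length (encode n ss) = length (snd (shed 1 x)) + length bs"
    by (simp add: encode_def x)
  ultimately show ?thesis
    using ans_length[of n ss] shed_1_length[OF xp] x assms
    unfolding abs_le_iff by (auto simp del: of_nat_add of_nat_mult of_nat_Suc zero_le_log_cancel_iff)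
qed

text \<open>A crude worst-case bound. It keeps input positions within a word, bounds the running
  time of the decoder and gives integrability of the code length.\<close>

lemma encode_length_le:
  assumes "length ss = n"
  shows "length (encode n ss) \<le> 6 * n + 6"
proof -
  have "log 2 (3::real) \<le> 2"
    by (simp add: log_le_iff)
  then have "real n * log 2 3 \<le> real n * 2" by (intro mult_left_mono) auto
  moreover have "real (length (filter unary ss)) \<le> real n" using assms by auto
  moreover have "log 2 (real (3 * n + 3)) \<le> real (3 * n + 3)"
    by (rule order.strict_implies_order, rule log2_of_power_less) (simp_all add: less_exp)
  ultimately have "real (length (encode n ss)) \<le> real (6 * n + 6)"
    using encode_length[OF assms] by simp
  then show ?thesis by linarith
qed

subsection \<open>The decoder\<close>

text \<open>
  Register 0 holds the top of the stack, 2 the number \<open>3 n + 3\<close>, 3 the state of the numeral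
  system, 4 the address of the next node and 5 the position in the input; 12, 13, 14 and 15 hold
  the constants 2, 1, 3 and 0. A node at \<open>p\<close> owns a third cell \<open>p + 2\<close> that points to the stack
  element below it, so nodes lie at multiples of 3 and \<open>3 n + 3\<close> is both the renormalisation
  threshold and the final value of register 4. The loop at 8 reads a bit if the state is too
  small and otherwise, from 17 on, decodes one node.
\<close>

definition decoder :: "instr list" where
  "decoder = [
    Const 14 3,
    Const 12 2,
    Const 13 1,
    Binop Add 2 0 13,
    Binop Mul 2 2 14,
    Const 0 0,
    Const 3 1,
    Const 4 3,
    Binop Less 6 3 2,
    JumpZero 6 15,
    Input 6 5,
    Binop Add 5 5 13,
    Binop Add 3 3 3,
    Binop Add 3 3 6,
    Jump 8,
    Binop Less 6 4 2,
    JumpZero 6 41,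
    Binop Mod 7 3 14,
    Binop Div 3 3 14,
    Binop Div 8 7 12,
    Binop Mod 6 7 12,
    JumpZero 6 24,
    Input 8 5,
    Binop Add 5 5 13,
    Binop Less 9 8 7,
    Binop Mul 10 0 8,
    JumpZero 8 29,
    Binop Add 6 0 12,
    Load 0 6,
    Binop Mul 11 0 9,
    JumpZero 9 33,
    Binop Add 6 0 12,
    Load 0 6,
    Store 4 11,
    Binop Add 6 4 13,
    Store 6 10,
    Binop Add 6 4 12,
    Store 6 0,
    Binop Add 0 4 15,
    Binop Add 4 4 14,
    Jump 8]"

abbreviation state_at :: "nat \<Rightarrow> (nat \<Rightarrow> nat) \<Rightarrow> (nat \<Rightarrow> nat) \<Rightarrow> ram_state" where
  "state_at l R M \<equiv> \<lparr>pc = l, reg = R, mem = M\<rparr>"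

lemma step_decoder:
  "step w bs decoder (state_at l R M) =
    (if l < 41 then exec w bs (decoder ! l) (state_at l R M) else state_at l R M)"
  by (simp add: step_def halted_def decoder_def)

lemma decoder_code:
  "decoder ! 0 = Const 14 3"
  "decoder ! Suc 0 = Const 12 2"
  "decoder ! 2 = Const 13 1"
  "decoder ! 3 = Binop Add 2 0 13"
  "decoder ! 4 = Binop Mul 2 2 14"
  "decoder ! 5 = Const 0 0"
  "decoder ! 6 = Const 3 1"
  "decoder ! 7 = Const 4 3"
  "decoder ! 8 = Binop Less 6 3 2"
  "decoder ! 9 = JumpZero 6 15"
  "decoder ! 10 = Input 6 5"
  "decoder ! 11 = Binop Add 5 5 13"
  "decoder ! 12 = Binop Add 3 3 3"
  "decoder ! 13 = Binop Add 3 3 6"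
  "decoder ! 14 = Jump 8"
  "decoder ! 15 = Binop Less 6 4 2"
  "decoder ! 16 = JumpZero 6 41"
  "decoder ! 17 = Binop Mod 7 3 14"
  "decoder ! 18 = Binop Div 3 3 14"
  "decoder ! 19 = Binop Div 8 7 12"
  "decoder ! 20 = Binop Mod 6 7 12"
  "decoder ! 21 = JumpZero 6 24"
  "decoder ! 22 = Input 8 5"
  "decoder ! 23 = Binop Add 5 5 13"
  "decoder ! 24 = Binop Less 9 8 7"
  "decoder ! 25 = Binop Mul 10 0 8"
  "decoder ! 26 = JumpZero 8 29"
  "decoder ! 27 = Binop Add 6 0 12"
  "decoder ! 28 = Load 0 6"
  "decoder ! 29 = Binop Mul 11 0 9"
  "decoder ! 30 = JumpZero 9 33"
  "decoder ! 31 = Binop Add 6 0 12"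
  "decoder ! 32 = Load 0 6"
  "decoder ! 33 = Store 4 11"
  "decoder ! 34 = Binop Add 6 4 13"
  "decoder ! 35 = Store 6 10"
  "decoder ! 36 = Binop Add 6 4 12"
  "decoder ! 37 = Store 6 0"
  "decoder ! 38 = Binop Add 0 4 15"
  "decoder ! 39 = Binop Add 4 4 14"
  "decoder ! 40 = Jump 8"
  by (simp_all add: decoder_def)

lemma funpow_numeral: "(f ^^ numeral k) x = (f ^^ pred_numeral k) (f x)"
  by (simp add: numeral_eq_Suc funpow_swap1)

text \<open>Symbolic execution by the simplifier: a numeral number of steps is unrolled, each
  instruction is looked up, and truncation to the word size disappears once the value is known to
  fit.\<close>

lemmas simulate = funpow_numeral step_decoder decoder_code numeral_2_eq_2[symmetric] take_bit_nat_eq_self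

section \<open>Postorder and a stack of subtrees in memory\<close>

fun postorder :: "unit tree \<Rightarrow> (bool \<times> bool) list" where
  "postorder Leaf = []"
| "postorder (Node l _ r) = postorder l @ postorder r @ [(l \<noteq> Leaf, r \<noteq> Leaf)]"

text \<open>This is the stack machine that the RAM program implements. The right subtree is
  completed after the left one, so it lies on top when both exist; empty subtrees are never
  pushed.\<close>

fun build :: "(bool \<times> bool) list \<Rightarrow> unit tree list \<Rightarrow> unit tree list option" where
  "build [] S = Some S"
| "build ((False, False) # ss) S = build ss (Node Leaf () Leaf # S)"
| "build ((True, False) # ss) (l # S) = build ss (Node l () Leaf # S)"
| "build ((False, True) # ss) (r # S) = build ss (Node Leaf () r # S)"
| "build ((True, True) # ss) (r # l # S) = build ss (Node l () r # S)"
| "build _ _ = None"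

lemma length_postorder: "length (postorder t) = size t"
  by (induction t) auto

lemma build_postorder:
  "build (postorder t @ ss) S = build ss (if t = Leaf then S else t # S)"
proof (induction t arbitrary: ss S)
  case (Node l u r)
  then show ?case by (cases "l = Leaf"; cases "r = Leaf") simp_all
qed simp

fun linked_stack :: "(nat \<Rightarrow> nat) \<Rightarrow> nat \<Rightarrow> unit tree list \<Rightarrow> bool" where
  "linked_stack M a [] \<longleftrightarrow> a = 0"
| "linked_stack M a (t # S) \<longleftrightarrow>
    t \<noteq> Leaf \<and> linked_tree M a t \<and> linked_stack M (M (a + 2)) S"

fun stack_cells :: "(nat \<Rightarrow> nat) \<Rightarrow> nat \<Rightarrow> unit tree list \<Rightarrow> nat list" where
  "stack_cells M a [] = []"
| "stack_cells M a (t # S) = (a + 2) # tree_cells M a t @ stack_cells M (M (a + 2)) S"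

lemma linked_tree_cong:
  assumes "\<And>c. c \<in> set (tree_cells M a t) \<Longrightarrow> M' c = M c"
  shows "linked_tree M' a t = linked_tree M a t \<and> tree_cells M' a t = tree_cells M a t"
  using assms by (induction t arbitrary: a) auto

lemma linked_stack_cong:
  assumes "\<And>c. c \<in> set (stack_cells M a S) \<Longrightarrow> M' c = M c"
  shows "linked_stack M' a S = linked_stack M a S \<and> stack_cells M' a S = stack_cells M a S"
  using assms
proof (induction S arbitrary: a)
  case (Cons t S)
  have "linked_tree M' a t = linked_tree M a t \<and> tree_cells M' a t = tree_cells M a t"
    by (rule linked_tree_cong) (use Cons.prems in auto)
  moreover have "M' (a + 2) = M (a + 2)" using Cons.prems by simp
  ultimately show ?case using Cons.IH[of "M (a + 2)"] Cons.prems by simp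
qed simp

text \<open>Here \<open>p\<close> is the next free address: everything in use lies below it, so
  writing a new node cannot damage the stack. It is positive because address 0 stands for the empty
  tree.\<close>

definition stack_below :: "(nat \<Rightarrow> nat) \<Rightarrow> nat \<Rightarrow> nat \<Rightarrow> unit tree list \<Rightarrow> bool" where
  "stack_below M p a S \<longleftrightarrow> 0 < p \<and> linked_stack M a S \<and> distinct (stack_cells M a S) \<and>
    set (stack_cells M a S) \<subseteq> {..<p}"

lemma stack_below_less: "stack_below M p a S \<Longrightarrow> a < p"
  by (cases S) (auto simp: stack_below_def)

lemma stack_below_tl: "stack_below M p a (t # S) \<Longrightarrow> stack_below M p (M (a + 2)) S"
  by (auto simp: stack_below_def)

text \<open>One lemma serves all four kinds of node, an absent child being \<open>Leaf\<close> at
  address 0. The children were separate stack elements, so their cells are disjoint and nothing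
  becomes shared.\<close>

lemma stack_below_push:
  assumes "0 < p" "linked_tree M al l" "linked_tree M ar r" "linked_stack M q S"
    and dist: "distinct (tree_cells M al l @ tree_cells M ar r @ stack_cells M q S)"
    and less: "set (tree_cells M al l @ tree_cells M ar r @ stack_cells M q S) \<subseteq> {..<p}"
    and M': "M' = M(p := al, p + 1 := ar, p + 2 := q)"
  shows "stack_below M' (p + 3) p (Node l () r # S)"
proof -
  have eq: "M' c = M c" if "c < p" for c
    using that by (simp add: M')
  have l: "linked_tree M' al l = linked_tree M al l \<and> tree_cells M' al l = tree_cells M al l"
    by (rule linked_tree_cong) (use less eq in auto)
  have r: "linked_tree M' ar r = linked_tree M ar r \<and> tree_cells M' ar r = tree_cells M ar r"
    by (rule linked_tree_cong) (use less eq in auto)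
  have S: "linked_stack M' q S = linked_stack M q S \<and> stack_cells M' q S = stack_cells M q S"
    by (rule linked_stack_cong) (use less eq in auto)
  have [simp]: "M' p = al" "M' (Suc p) = ar" "M' (Suc (Suc p)) = q" by (simp_all add: M')
  have sub: "set (tree_cells M al l) \<subseteq> {..<p}" "set (tree_cells M ar r) \<subseteq> {..<p}"
    "set (stack_cells M q S) \<subseteq> {..<p}" using less by auto
  then have "c \<notin> set (tree_cells M al l)" "c \<notin> set (tree_cells M ar r)"
      "c \<notin> set (stack_cells M q S)" if "p \<le> c" for c
    using that by auto
  moreover have "{..<p} \<subseteq> {..<p + 3}" by auto
  ultimately show ?thesis
    using assms(1-5) l r S sub unfolding stack_below_def by auto
qed

section \<open>Simulation of the decoder on the word RAM\<close>

locale decoder_run =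
  fixes n w :: nat and bs :: "bool list"
  assumes word: "64 * (n + 2) < 2 ^ w"
    and input_length: "length bs \<le> 6 * n + 6"
begin

abbreviation run :: "nat \<Rightarrow> ram_state \<Rightarrow> ram_state" where
  "run k s \<equiv> (step w bs decoder ^^ k) s"

text \<open>The register part of the loop invariant. Registers 6 to 11 are scratch and may hold
  anything between iterations.\<close>

definition ready :: "(nat \<Rightarrow> nat) \<Rightarrow> nat \<Rightarrow> bool list \<Rightarrow> nat \<Rightarrow> nat \<Rightarrow> bool" where
  "ready R x rest p a \<longleftrightarrow>
    R 2 = 3 * n + 3 \<and> R 12 = 2 \<and> R 13 = 1 \<and> R 14 = 3 \<and> R 15 = 0 \<and>
    R 3 = x \<and> drop (R 5) bs = rest \<and> R 4 = p \<and> R 0 = a"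

text \<open>The numeral state and the input position never exceed \<open>6 * n + 6\<close>, and
  addresses stay within a few cells of \<open>3 * n + 3\<close>. The generous factor 64 thus makes
  arithmetic modulo the word size exact.\<close>

lemma fits: "v \<le> 64 * (n + 2) \<Longrightarrow> v < 2 ^ w"
  using word by simp

lemma word_size_ge: "7 \<le> w"
proof -
  have "(2::nat) ^ 7 < 2 ^ w" using word by simp
  then show ?thesis using power_less_imp_less_exp[of "2 :: nat" 7 w] by simp
qed

lemma run_init:
  "\<exists>R. run 8 (init_state w n bs) = state_at 8 R (\<lambda>_. 0) \<and> ready R 1 bs 3 0"
  using word_size_ge by (simp add: init_state_def simulate fits ready_def)

lemma drop_eq_ConsD: "drop i xs = y # ys \<Longrightarrow> i < length xs \<and> xs ! i = y \<and> drop (Suc i) xs = ys"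
  by (metis Cons_nth_drop_Suc drop_eq_Nil leI list.distinct(1) list.inject)

lemma run_read:
  assumes "ready R x (b # rest) p a" "x < 3 * n + 3"
  shows "\<exists>R'. run 7 (state_at 8 R M) = state_at 8 R' M \<and> ready R' (2 * x + of_bool b) rest p a"
proof -
  have "drop (R 5) bs = b # rest" using assms by (simp add: ready_def)
  note drop_eq_ConsD[OF this]
  then show ?thesis
    using assms input_length word_size_ge by (simp add: simulate fits ready_def)
qed

lemma run_exit:
  assumes "ready R x rest p a" "3 * n + 3 \<le> x" "3 * n + 3 \<le> p"
  shows "\<exists>R'. run 4 (state_at 8 R M) = state_at 41 R' M \<and> R' 0 = a"
  using assms word_size_ge by (simp add: simulate fits ready_def)

text \<open>In all four node cases the program computes in register 8 whether there is a right child
  and in register 9 whether there is a left one. Register 8 starts as the trit divided by 2 and is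
  replaced by an input bit if the trit is 1; register 9 tests whether register 8 is less than the
  trit. Multiplying the stack top by these flags yields either the child's address or 0.\<close>

lemma run_leaf:
  assumes "ready R x rest p a" "3 * n + 3 \<le> x" "x < 6 * n + 6" "p < 3 * n + 3" "a < p"
    "x mod 3 = 0"
  shows "\<exists>R'. run 22 (state_at 8 R M) = state_at 8 R' (M(p := 0, p + 1 := 0, p + 2 := a)) \<and>
    ready R' (x div 3) rest (p + 3) p"
  using assms word_size_ge by (simp add: simulate fits ready_def)

lemma run_both:
  assumes "ready R x rest p a" "3 * n + 3 \<le> x" "x < 6 * n + 6" "p < 3 * n + 3" "a < p"
    "x mod 3 = 2" "M (a + 2) < p"
  shows "\<exists>R'. run 26 (state_at 8 R M) =
      state_at 8 R' (M(p := M (a + 2), p + 1 := a, p + 2 := M (M (a + 2) + 2))) \<and>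
    ready R' (x div 3) rest (p + 3) p"
  using assms word_size_ge by (simp add: simulate fits ready_def)

lemma run_left:
  assumes "ready R x (False # rest) p a" "3 * n + 3 \<le> x" "x < 6 * n + 6" "p < 3 * n + 3" "a < p"
    "x mod 3 = 1" "M (a + 2) < p"
  shows "\<exists>R'. run 26 (state_at 8 R M) = state_at 8 R' (M(p := a, p + 1 := 0, p + 2 := M (a + 2))) \<and>
    ready R' (x div 3) rest (p + 3) p"
proof -
  have "drop (R 5) bs = False # rest" using assms by (simp add: ready_def)
  note drop_eq_ConsD[OF this]
  then show ?thesis
    using assms input_length word_size_ge by (simp add: simulate fits ready_def)
qed

lemma run_right:
  assumes "ready R x (True # rest) p a" "3 * n + 3 \<le> x" "x < 6 * n + 6" "p < 3 * n + 3" "a < p"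
    "x mod 3 = 1" "M (a + 2) < p"
  shows "\<exists>R'. run 26 (state_at 8 R M) = state_at 8 R' (M(p := 0, p + 1 := a, p + 2 := M (a + 2))) \<and>
    ready R' (x div 3) rest (p + 3) p"
proof -
  have "drop (R 5) bs = True # rest" using assms by (simp add: ready_def)
  note drop_eq_ConsD[OF this]
  then show ?thesis
    using assms input_length word_size_ge by (simp add: simulate fits ready_def)
qed

lemma run_symbol:
  assumes R: "ready R x ((if l \<noteq> r then [r] else []) @ rest) p a"
    and x: "3 * n + 3 \<le> x" "x < 6 * n + 6" and p: "p < 3 * n + 3"
    and d: "x mod 3 = of_bool l + of_bool r"
    and S: "stack_below M p a S" and b: "build ((l, r) # ss) S = Some S'"
  shows "\<exists>k\<le>26. \<exists>R' M' S1. run k (state_at 8 R M) = state_at 8 R' M' \<and> ready R' (x div 3) rest (p + 3) p \<and>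
    stack_below M' (p + 3) p S1 \<and> build ss S1 = Some S'"
proof -
  have a: "a < p" using stack_below_less[OF S] .
  \<comment> \<open>Since \<open>build\<close> succeeds, the stack is deep enough for the pops that
    the symbol demands.\<close>
  consider "\<not> l" "\<not> r"
    | t S0 where "l" "\<not> r" "S = t # S0"
    | t S0 where "\<not> l" "r" "S = t # S0"
    | tl tr S0 where "l" "r" "S = tr # tl # S0"
    using b by (cases l; cases r; cases S; cases "tl S") auto
  then show ?thesis
  proof cases
    case 1
    let ?M = "M(p := 0, p + 1 := 0, p + 2 := a)"
    obtain R' where "run 22 (state_at 8 R M) = state_at 8 R' ?M" "ready R' (x div 3) rest (p + 3) p"
      using run_leaf[of R x rest p a M] R x p a d 1 by auto
    moreover have "stack_below ?M (p + 3) p (Node Leaf () Leaf # S)"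
      by (rule stack_below_push) (use S in \<open>auto simp: stack_below_def\<close>)
    moreover have "build ss (Node Leaf () Leaf # S) = Some S'" using b 1 by simp
    ultimately show ?thesis by (intro exI[of _ 22]) auto
  next
    case (2 t S0)
    let ?M = "M(p := a, p + 1 := 0, p + 2 := M (a + 2))"
    have "M (a + 2) < p" using stack_below_less[OF stack_below_tl] S 2 by blast
    then obtain R' where "run 26 (state_at 8 R M) = state_at 8 R' ?M" "ready R' (x div 3) rest (p + 3) p"
      using run_left[of R x rest p a M] R x p a d 2 by auto
    moreover have "stack_below ?M (p + 3) p (Node t () Leaf # S0)"
      by (rule stack_below_push) (use S 2 in \<open>auto simp: stack_below_def\<close>)
    moreover have "build ss (Node t () Leaf # S0) = Some S'" using b 2 by simp
    ultimately show ?thesis by (intro exI[of _ 26]) auto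
  next
    case (3 t S0)
    let ?M = "M(p := 0, p + 1 := a, p + 2 := M (a + 2))"
    have "M (a + 2) < p" using stack_below_less[OF stack_below_tl] S 3 by blast
    then obtain R' where "run 26 (state_at 8 R M) = state_at 8 R' ?M" "ready R' (x div 3) rest (p + 3) p"
      using run_right[of R x rest p a M] R x p a d 3 by auto
    moreover have "stack_below ?M (p + 3) p (Node Leaf () t # S0)"
      by (rule stack_below_push) (use S 3 in \<open>auto simp: stack_below_def\<close>)
    moreover have "build ss (Node Leaf () t # S0) = Some S'" using b 3 by simp
    ultimately show ?thesis by (intro exI[of _ 26]) auto
  next
    case (4 tl tr S0)
    let ?M = "M(p := M (a + 2), p + 1 := a, p + 2 := M (M (a + 2) + 2))"
    have "M (a + 2) < p" using stack_below_less[OF stack_below_tl] S 4 by blast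
    then obtain R' where "run 26 (state_at 8 R M) = state_at 8 R' ?M" "ready R' (x div 3) rest (p + 3) p"
      using run_both[of R x rest p a M] R x p a d 4 by auto
    moreover have "stack_below ?M (p + 3) p (Node tl () tr # S0)"
      by (rule stack_below_push) (use S 4 in \<open>auto simp: stack_below_def\<close>)
    moreover have "build ss (Node tl () tr # S0) = Some S'" using b 4 by simp
    ultimately show ?thesis by (intro exI[of _ 26]) auto
  qed
qed

lemma run_add: "run (j + k) s = run k (run j s)"
  by (subst add.commute) (simp add: funpow_add)

text \<open>The states passed through are binary prefixes of \<open>x\<close>. Before the last bit
  is read the state is at most \<open>x div 2\<close>, which is below the threshold
  \<open>3 * n + 3\<close>, so the loop keeps reading instead of decoding a node. Each bit takes 7
  steps.\<close>

lemma run_shed: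
  assumes "ready R (fst (shed b x)) (snd (shed b x) @ rest) p a" "x < 6 * n + 6"
  shows "\<exists>R'. run (7 * length (snd (shed b x))) (state_at 8 R M) = state_at 8 R' M \<and> ready R' x rest p a"
  using assms
proof (induction b x arbitrary: R rest rule: shed.induct)
  case (1 b x)
  show ?case
  proof (cases "x \<le> b")
    case True
    with 1(2) show ?thesis by (auto simp: shed.simps[of b x])
  next
    case False
    let ?y = "shed b (x div 2)"
    have e: "shed b x = (fst ?y, snd ?y @ [odd x])"
      using False by (simp add: shed.simps[of b x] split: prod.splits)
    obtain R1 where R1: "run (7 * length (snd ?y)) (state_at 8 R M) = state_at 8 R1 M"
      "ready R1 (x div 2) (odd x # rest) p a"
      using 1(1)[OF False, of R "odd x # rest"] 1(2) le_less_trans[OF div_le_dividend 1(3)]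
      by (auto simp: e)
    obtain R2 where R2: "run 7 (state_at 8 R1 M) = state_at 8 R2 M"
        "ready R2 (2 * (x div 2) + of_bool (odd x)) rest p a"
      using run_read[OF R1(2), of M] 1(3) by fastforce
    moreover have "2 * (x div 2) + of_bool (odd x) = x" by (simp add: of_bool_def)
    moreover have "7 * length (snd (shed b x)) = 7 * length (snd ?y) + 7" by (simp add: e)
    ultimately show ?thesis by (simp only: run_add R1(1)) metis
  qed
qed

text \<open>The head of the list was absorbed last and is therefore decoded first: division by 3
  recovers the trit and \<open>y\<close>, and reading the shed bits restores the state of the
  remaining list. A node takes at most 26 steps besides the 7 per restored bit, and the empty list
  is reached exactly when the node addresses are used up.\<close>

lemma run_symbols:
  assumes "ready R (fst (ans n ss)) (snd (ans n ss)) p a" "stack_below M p a S"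
    "p + 3 * length ss = 3 * n + 3" "build ss S = Some S'"
  shows "\<exists>k \<le> 26 * length ss + 7 * length (snd (ans n ss)). \<exists>R' M' rest a'.
    run k (state_at 8 R M) = state_at 8 R' M' \<and> ready R' (3 * n + 3) rest (3 * n + 3) a' \<and>
    stack_below M' (3 * n + 3) a' S'"
  using assms
proof (induction ss arbitrary: R M p a S)
  case Nil
  then show ?case by (intro exI[of _ 0]) auto
next
  case (Cons s ss)
  obtain l r where s: "s = (l, r)" by fastforce
  obtain x0 bs0 where x0: "ans n ss = (x0, bs0)" by fastforce
  obtain y cs where y: "shed (2 * n + 1) x0 = (y, cs)" by fastforce
  define x where "x = 3 * y + (of_bool l + of_bool r)"
  have e: "ans n (s # ss) = (x, (if l \<noteq> r then [r] else []) @ cs @ bs0)"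
    by (simp add: s x0 y x_def del: One_nat_def add_Suc_right)
  have d: "of_bool l + of_bool r < (3::nat)" by simp
  then have x: "x mod 3 = of_bool l + of_bool r" "x div 3 = y"
    by (simp_all only: x_def mod_mult_self4 mod_less div_mult_self4)
  have "3 * n + 3 \<le> x" "x < 6 * n + 6" using ans_range[of n "s # ss"] by (simp_all add: e)
  moreover have "p < 3 * n + 3" using Cons.prems(3) by simp
  ultimately obtain k1 R1 M1 S1 where k1: "k1 \<le> 26" "run k1 (state_at 8 R M) = state_at 8 R1 M1"
    and R1: "ready R1 y (cs @ bs0) (p + 3) p"
    and S1: "stack_below M1 (p + 3) p S1" "build ss S1 = Some S'"
    using run_symbol[of R x l r "cs @ bs0" p a M S ss S'] x
      Cons.prems(1)[unfolded e fst_conv snd_conv] Cons.prems(2,4) by (auto simp: s)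
  obtain R2 where R2: "run (7 * length cs) (state_at 8 R1 M1) = state_at 8 R2 M1" "ready R2 x0 bs0 (p + 3) p"
    using run_shed[of R1 "2 * n + 1" x0 bs0 "p + 3" p M1] R1 ans_range[of n ss] y x0 by auto
  obtain k3 R3 M3 rest a' where k3: "k3 \<le> 26 * length ss + 7 * length bs0"
    "run k3 (state_at 8 R2 M1) = state_at 8 R3 M3"
    and fin: "ready R3 (3 * n + 3) rest (3 * n + 3) a'" "stack_below M3 (3 * n + 3) a' S'"
    using Cons.IH[of R2 "p + 3" p M1 S1] R2(2) S1 Cons.prems(3) by (auto simp: x0)
  have "run (k1 + 7 * length cs + k3) (state_at 8 R M) = state_at 8 R3 M3"
    by (simp only: run_add k1 R2 k3)
  moreover have "k1 + 7 * length cs + k3 \<le> 26 * length (s # ss) + 7 * length (snd (ans n (s # ss)))"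
    using k1(1) k3(1) by (simp add: e)
  ultimately show ?case using fin by blast
qed

lemma run_halted: "halted decoder s \<Longrightarrow> run k s = s"
  by (induction k) (simp_all add: step_def)

lemma decoder_correct:
  assumes t: "size t = n" and bs: "bs = encode n (postorder t)"
  defines "s \<equiv> run (100 * (n + 1)) (init_state w n bs)"
  shows "halted decoder s \<and> stores_tree (mem s) (reg s 0) t"
proof -
  let ?ss = "postorder t"
  let ?S = "if t = Leaf then [] else [t]"
  obtain x bs0 where x: "ans n ?ss = (x, bs0)" by fastforce
  let ?c = "snd (shed 1 x)"
  have b: "bs = ?c @ bs0" by (simp add: bs encode_def x)
  obtain R0 where R0: "run 8 (init_state w n bs) = state_at 8 R0 (\<lambda>_. 0)" "ready R0 1 bs 3 0"
    using run_init by blast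
  have xb: "3 * n + 3 \<le> x" "x < 6 * n + 6" using ans_range[of n ?ss] x by auto
  have "fst (shed 1 x) = 1"
    using shed_le[of 1 x] shed_ge[of 1 x 1] xb by auto
  then obtain R1 where R1: "run (7 * length ?c) (state_at 8 R0 (\<lambda>_. 0)) = state_at 8 R1 (\<lambda>_. 0)"
      "ready R1 x bs0 3 0"
    using run_shed[of R0 1 x bs0 3 0 "\<lambda>_. 0"] R0(2) xb b by auto
  obtain k R2 M rest a where k: "k \<le> 26 * n + 7 * length bs0"
    "run k (state_at 8 R1 (\<lambda>_. 0)) = state_at 8 R2 M"
    and R2: "ready R2 (3 * n + 3) rest (3 * n + 3) a" "stack_below M (3 * n + 3) a ?S"
    using run_symbols[of R1 ?ss 3 0 "\<lambda>_. 0" "[]" ?S] R1(2) x t build_postorder[of t "[]" "[]"]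
    by (auto simp: length_postorder stack_below_def)
  obtain R3 where R3: "run 4 (state_at 8 R2 M) = state_at 41 R3 M" "R3 0 = a"
    using run_exit[OF R2(1)] by blast
  define K where "K = 8 + 7 * length ?c + k + 4"
  have K: "run K (init_state w n bs) = state_at 41 R3 M"
    unfolding K_def run_add R0 R1 k R3 ..
  have h: "halted decoder (state_at 41 R3 M)" by (simp add: halted_def decoder_def)
  \<comment> \<open>The total is at most \<open>12 + 26 * n + 7 * (6 * n + 6)\<close>; the surplus
    steps leave the halted machine unchanged.\<close>
  have "K \<le> 100 * (n + 1)"
    using input_length k(1) by (simp add: K_def b)
  then have "s = state_at 41 R3 M"
    unfolding s_def using run_add[of K "100 * (n + 1) - K"] K run_halted[OF h] by simp
  moreover have "stores_tree M a t"
    using R2(2) by (cases "t = Leaf") (auto simp: stores_tree_def stack_below_def)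
  ultimately show ?thesis using h R3(2) by simp
qed

end

subsection \<open>Cartesian trees\<close>

text \<open>With ties the maximum position is an arbitrary choice, but the choice is made from a
  predicate that depends only on comparisons. This lets measurability be shown on all arrays and not
  only on distinct ones.\<close>

lemma arg_max_on_cong_less:
  assumes "\<And>a b. a \<in> S \<Longrightarrow> b \<in> S \<Longrightarrow> A a < A b \<longleftrightarrow> B a < B b"
  shows "arg_max_on A S = arg_max_on B S"
proof -
  have "is_arg_max A (\<lambda>x. x \<in> S) = is_arg_max B (\<lambda>x. x \<in> S)"
    using assms by (auto simp: is_arg_max_def fun_eq_iff)
  then show ?thesis by (simp add: arg_max_on_def arg_max_def)
qed

lemma arg_max_on_eqI:
  fixes A :: "'a \<Rightarrow> 'b :: linorder"
  assumes "finite S" "inj_on A S" "x \<in> S" "\<And>y. y \<in> S \<Longrightarrow> A y \<le> A x"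
  shows "arg_max_on A S = x"
proof -
  have S: "S \<noteq> {}" using assms by auto
  have "A x \<le> A (arg_max_on A S)"
    using is_arg_max_arg_max_on[OF assms(1) S, of A] assms(3) by (auto simp: is_arg_max_def not_less)
  then have "A (arg_max_on A S) = A x"
    using assms(4)[OF arg_max_on_in[OF assms(1) S, of A]] by simp
  then show ?thesis
    using assms(2,3) arg_max_on_in[OF assms(1) S, of A] by (auto dest: inj_onD)
qed

lemma arg_max_on_ge:
  fixes A :: "'a \<Rightarrow> 'b :: linorder"
  assumes "finite S" "y \<in> S"
  shows "A y \<le> A (arg_max_on A S)"
  using is_arg_max_arg_max_on[of S A] assms by (auto simp: is_arg_max_def not_less)

lemma cartesian_seg_Leaf: "j \<le> i \<Longrightarrow> cartesian_seg A i j = Leaf"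
  by (simp add: cartesian_seg.simps)

lemma cartesian_seg_Node:
  assumes "i < j" "m = arg_max_on A {i..<j}"
  shows "cartesian_seg A i j = Node (cartesian_seg A i m) () (cartesian_seg A (m + 1) j)"
  using assms by (simp add: cartesian_seg.simps[of A i j] Let_def)

lemma cartesian_seg_induct [case_names Leaf Node]:
  fixes A :: "nat \<Rightarrow> real"
  assumes "\<And>i j. j \<le> i \<Longrightarrow> P i j"
    and "\<And>i j m. i \<le> m \<Longrightarrow> m < j \<Longrightarrow> m = arg_max_on A {i..<j} \<Longrightarrow> P i m \<Longrightarrow> P (m + 1) j \<Longrightarrow> P i j"
  shows "P i j"
proof (induction "j - i" arbitrary: i j rule: less_induct)
  case less
  show ?case
  proof (cases "i < j")
    case True
    define m where "m = arg_max_on A {i..<j}"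
    have "m \<in> {i..<j}" using arg_max_on_in[of "{i..<j}" A] True by (simp add: m_def)
    then show ?thesis
      by (intro assms(2)[of i m j] less.hyps) (auto simp: m_def)
  qed (simp add: assms(1))
qed

lemma cartesian_seg_cong:
  assumes "\<And>a b. a \<in> {i..<j} \<Longrightarrow> b \<in> {i..<j} \<Longrightarrow> A a < A b \<longleftrightarrow> B a < B b"
  shows "cartesian_seg A i j = cartesian_seg B i j"
  using assms
proof (induction i j rule: cartesian_seg_induct[where A = A])
  case (Leaf i j)
  then show ?case by (simp add: cartesian_seg_Leaf)
next
  case (Node i j m)
  have "m = arg_max_on B {i..<j}"
    unfolding Node.hyps(3) by (rule arg_max_on_cong_less) (use Node.prems in auto)
  moreover have "cartesian_seg A i m = cartesian_seg B i m"
    by (rule Node.IH(1)) (use Node in auto)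
  moreover have "cartesian_seg A (m + 1) j = cartesian_seg B (m + 1) j"
    by (rule Node.IH(2)) (use Node in auto)
  ultimately show ?case
    using Node.hyps cartesian_seg_Node[of i j m A] cartesian_seg_Node[of i j m B] by simp
qed

lemma size_cartesian_seg: "size (cartesian_seg A i j) = j - i"
proof (induction i j rule: cartesian_seg_induct[where A = A])
  case (Node i j m)
  then show ?case using cartesian_seg_Node[of i j m A] by simp
qed (simp add: cartesian_seg_Leaf)

lemma cartesian_seg_eq_Leaf_iff: "cartesian_seg A i j = Leaf \<longleftrightarrow> j \<le> i"
  by (metis cartesian_seg_Leaf diff_is_0_eq size_cartesian_seg tree.size(3))

text \<open>The size of the left subtree fixes the position of the root, so both arrays have their
  maximum at the same place. A query range either contains that position, which is then the answer,
  or lies on one side of it and is settled by a subtree.\<close>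

lemma range_max_from_cartesian_seg:
  assumes "cartesian_seg A a b = cartesian_seg B a b"
    and "inj_on A {a..<b}" "inj_on B {a..<b}" "a \<le> i" "i \<le> j" "j < b"
  shows "arg_max_on A {i..j} = arg_max_on B {i..j}"
  using assms
proof (induction a b arbitrary: i j rule: cartesian_seg_induct[where A = A])
  case (Leaf a b)
  then show ?case by simp
next
  case (Node a b m)
  define m' where "m' = arg_max_on B {a..<b}"
  have "a < b" using Node.hyps by simp
  note eq = Node.prems(1)[unfolded cartesian_seg_Node[OF \<open>a < b\<close> Node.hyps(3)]
      cartesian_seg_Node[OF \<open>a < b\<close> m'_def]]
  have m': "m' \<in> {a..<b}" unfolding m'_def by (rule arg_max_on_in) (use \<open>a < b\<close> in auto)
  have "m - a = m' - a"
    using eq by (metis size_cartesian_seg tree.inject)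
  then have mm: "m' = m" using m' Node.hyps by auto
  have leA: "A k \<le> A m" and leB: "B k \<le> B m" if "k \<in> {a..<b}" for k
    using arg_max_on_ge[of "{a..<b}" k A] arg_max_on_ge[of "{a..<b}" k B] that
    unfolding Node.hyps(3)[symmetric] m'_def[symmetric] mm by auto
  have inj: "inj_on A X" "inj_on B X" if "X \<subseteq> {a..<b}" for X
    using Node.prems(2,3) that by (auto intro: inj_on_subset)
  consider "j < m" | "m < i" | "i \<le> m" "m \<le> j" by linarith
  then show ?case
  proof cases
    case 1
    show ?thesis
      by (rule Node.IH(1)) (use eq mm 1 Node.prems Node.hyps in \<open>auto intro!: inj\<close>)
  next
    case 2
    show ?thesis
      by (rule Node.IH(2)) (use eq mm 2 Node.prems Node.hyps in \<open>auto intro!: inj\<close>)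
  next
    case 3
    have "arg_max_on A {i..j} = m"
      by (rule arg_max_on_eqI) (use 3 Node.prems in \<open>auto intro!: inj leA\<close>)
    moreover have "arg_max_on B {i..j} = m"
      by (rule arg_max_on_eqI) (use 3 Node.prems in \<open>auto intro!: inj leB\<close>)
    ultimately show ?thesis by simp
  qed
qed

definition one_sided :: "(nat \<Rightarrow> real) \<Rightarrow> nat \<Rightarrow> nat \<Rightarrow> nat \<Rightarrow> bool" where
  "one_sided A i j k \<longleftrightarrow> (i < k \<and> A (k - 1) < A k) \<noteq> (k + 1 < j \<and> A (k + 1) < A k)"

text \<open>A position has a left child iff its left neighbour belongs to the segment and is
  smaller, and likewise on the right. Splitting at the maximum \<open>m\<close> preserves this: a
  position next to \<open>m\<close> loses a neighbour, but that neighbour was larger and never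
  counted.\<close>

lemma count_unary_cartesian_seg:
  assumes "inj_on A {i..<j}"
  shows "length (filter unary (postorder (cartesian_seg A i j))) =
    (\<Sum>k = i..<j. of_bool (one_sided A i j k))"
  using assms
proof (induction i j rule: cartesian_seg_induct[where A = A])
  case (Leaf i j)
  then show ?case by (simp add: cartesian_seg_Leaf)
next
  case (Node i j m)
  have ij: "i < j" using Node.hyps by simp
  have "A k \<le> A m" if "k \<in> {i..<j}" for k
    using arg_max_on_ge[of "{i..<j}" k A] that Node.hyps by auto
  moreover have "A k \<noteq> A m" if "k \<in> {i..<j}" "k \<noteq> m" for k
    using inj_onD[OF Node.prems, of k m] that Node.hyps by auto
  ultimately have less: "A k < A m" if "k \<in> {i..<j}" "k \<noteq> m" for k
    using that by (simp add: order.not_eq_order_implies_strict)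
  have L: "one_sided A i m k = one_sided A i j k" if "k \<in> {i..<m}" for k
    using that Node.hyps less[of "k + 1"] less[of k] less_asym
    by (cases "k + 1 = m") (auto simp: one_sided_def)
  have R: "one_sided A (m + 1) j k = one_sided A i j k" if "k \<in> {m + 1..<j}" for k
    using that Node.hyps less[of "k - 1"] less[of k] less_asym
    by (cases "k = m + 1") (auto simp: one_sided_def)
  have "one_sided A i j m \<longleftrightarrow> (i < m) \<noteq> (m + 1 < j)"
  proof -
    have "i < m \<Longrightarrow> A (m - 1) < A m" "m + 1 < j \<Longrightarrow> A (m + 1) < A m"
      using Node.hyps(1,2) by (auto intro!: less)
    then show ?thesis unfolding one_sided_def by blast
  qed
  then have M: "one_sided A i j m \<longleftrightarrow> unary (\<not> m \<le> i, \<not> j \<le> m + 1)"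
    by (auto simp: unary_def)
  have "{i..<j} = {i..<m} \<union> ({m} \<union> {m + 1..<j})" using Node.hyps by auto
  then have "sum h {i..<j} = sum h {i..<m} + (h m + sum h {m + 1..<j})" for h :: "nat \<Rightarrow> nat"
    by (simp add: sum.union_disjoint)
  then have "(\<Sum>k = i..<j. of_bool (one_sided A i j k)) =
    (\<Sum>k = i..<m. of_bool (one_sided A i j k)) + (of_bool (one_sided A i j m) +
    (\<Sum>k = m + 1..<j. of_bool (one_sided A i j k) :: nat))" .
  also have "(\<Sum>k = i..<m. of_bool (one_sided A i j k)) = (\<Sum>k = i..<m. of_bool (one_sided A i m k))"
    by (rule sum.cong[OF refl]) (simp only: L)
  also have "(\<Sum>k = m + 1..<j. of_bool (one_sided A i j k)) =
      (\<Sum>k = m + 1..<j. of_bool (one_sided A (m + 1) j k))"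
    by (rule sum.cong[OF refl]) (simp only: R)
  finally show ?case
    using Node.IH(1)[OF inj_on_subset[OF Node.prems]] Node.IH(2)[OF inj_on_subset[OF Node.prems]] Node.hyps M
      cartesian_seg_Node[OF ij Node.hyps(3)]
    by (auto simp: cartesian_seg_eq_Leaf_iff)
qed

subsection \<open>Random arrays\<close>

abbreviation unit_uniform :: "real measure" where
  "unit_uniform \<equiv> uniform_measure lborel {0..<1}"

lemma prob_space_unit_uniform: "prob_space unit_uniform"
  by (rule prob_space_uniform_measure) auto

lemma prob_space_uniform_array: "prob_space (uniform_array n)"
  unfolding uniform_array_def by (rule prob_space_PiM) (rule prob_space_unit_uniform)

lemma measurable_uniform_array_component:
  "i \<in> {1..n} \<Longrightarrow> (\<lambda>A. A i) \<in> borel_measurable (uniform_array n)"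
  unfolding uniform_array_def
  using measurable_component_singleton[of i "{1..n}" "\<lambda>_. unit_uniform"] by simp

lemma less_in_sets_uniform_array:
  assumes "i \<in> {1..n}" "j \<in> {1..n}"
  shows "{A \<in> space (uniform_array n). A i < A j} \<in> sets (uniform_array n)"
  using assms[THEN measurable_uniform_array_component] by (rule borel_measurable_less)

text \<open>By Fubini, integrate over coordinate \<open>i\<close> first: with the other entries
  fixed, equality forces \<open>A i\<close> into the single point \<open>A j\<close>, a null
  set.\<close>

lemma AE_uniform_array_neq:
  assumes ij: "i \<in> {1..n}" "j \<in> {1..n}" "i \<noteq> j"
  shows "AE A in uniform_array n. A i \<noteq> A j"
proof -
  interpret product_sigma_finite "\<lambda>_ :: nat. unit_uniform"
    by (intro product_sigma_finite.intro prob_space_imp_sigma_finite prob_space_unit_uniform)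
  define I where "I = {1..n} - {i}"
  have I: "insert i I = {1..n}" "finite I" "i \<notin> I" using ij by (auto simp: I_def)
  define E where "E = {A \<in> space (uniform_array n). A i = A j}"
  have E: "E \<in> sets (uniform_array n)"
    unfolding E_def using ij(1,2)[THEN measurable_uniform_array_component]
    by (rule borel_measurable_eq)
  have "emeasure (uniform_array n) E = integral\<^sup>N (uniform_array n) (indicator E)"
    using E by simp
  also have "\<dots> = (\<integral>\<^sup>+ A. (\<integral>\<^sup>+ y. indicator E (A(i := y)) \<partial>unit_uniform)
      \<partial>Pi\<^sub>M I (\<lambda>_. unit_uniform))"
    using product_nn_integral_insert[OF I(2,3), of "indicator E"] E
    unfolding uniform_array_def I(1) by simp
  also have "\<dots> = (\<integral>\<^sup>+ A. 0 \<partial>Pi\<^sub>M I (\<lambda>_. unit_uniform))"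
  proof (rule nn_integral_cong)
    fix A :: "nat \<Rightarrow> real"
    have "(\<integral>\<^sup>+ y. indicator E (A(i := y)) \<partial>unit_uniform) \<le>
        (\<integral>\<^sup>+ y. indicator {A j} y \<partial>unit_uniform)"
      by (rule nn_integral_mono) (use ij in \<open>auto simp: E_def indicator_def\<close>)
    also have "\<dots> = emeasure unit_uniform {A j}" by simp
    also have "\<dots> = 0"
    proof -
      have "emeasure lborel ({0..<1} \<inter> {A j}) \<le> emeasure lborel {A j}"
        by (rule emeasure_mono) auto
      then show ?thesis by simp
    qed
    finally show "(\<integral>\<^sup>+ y. indicator E (A(i := y)) \<partial>unit_uniform) = 0" by simp
  qed
  finally have "emeasure (uniform_array n) E = 0" by simp
  then show ?thesis
    using E by (intro AE_I[of _ _ E]) (auto simp: E_def)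
qed

lemma AE_uniform_array_inj: "AE A in uniform_array n. inj_on A {1..n}"
proof -
  have "AE A in uniform_array n. \<forall>i\<in>{1..n}. \<forall>j\<in>{1..n}. i \<noteq> j \<longrightarrow> A i \<noteq> A j"
    by (intro AE_finite_allI) (auto intro: AE_uniform_array_neq)
  then show ?thesis by eventually_elim (auto simp: inj_on_def)
qed

text \<open>For distinct entries this says that \<open>A b\<close> is the median of the three. The
  exclusive-or form agrees literally with \<open>one_sided\<close> at inner positions.\<close>

definition middle :: "nat \<Rightarrow> nat \<Rightarrow> nat \<Rightarrow> (nat \<Rightarrow> real) \<Rightarrow> bool" where
  "middle b a c A \<longleftrightarrow> (A a < A b) \<noteq> (A c < A b)"

lemma middle_in_sets [measurable]:
  assumes "a \<in> {1..n}" "b \<in> {1..n}" "c \<in> {1..n}"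
  shows "{A \<in> space (uniform_array n). middle b a c A} \<in> sets (uniform_array n)"
proof -
  note [measurable] = assms[THEN measurable_uniform_array_component]
  show ?thesis unfolding middle_def by measurable
qed

lemma distr_uniform_array_permute:
  assumes "f permutes {1..n}"
  shows "distr (uniform_array n) (uniform_array n) (\<lambda>A. \<lambda>k\<in>{1..n}. A (f k)) = uniform_array n"
  unfolding uniform_array_def
  by (rule distr_PiM_reindex)
    (use prob_space_unit_uniform permutes_inj_on[OF assms] permutes_in_image[OF assms] in auto)

text \<open>The entries are independent and identically distributed, so permuting coordinates
  preserves the measure.\<close>

lemma measure_middle_permute:
  assumes f: "f permutes {1..n}" and abc: "a \<in> {1..n}" "b \<in> {1..n}" "c \<in> {1..n}"
  shows "measure (uniform_array n) {A \<in> space (uniform_array n). middle (f b) (f a) (f c) A} =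
    measure (uniform_array n) {A \<in> space (uniform_array n). middle b a c A}"
proof -
  let ?U = "uniform_array n" and ?g = "\<lambda>A. \<lambda>k\<in>{1..n}. A (f k)"
  have g: "?g \<in> measurable ?U ?U"
    unfolding uniform_array_def
    by (rule measurable_restrict)
      (use permutes_in_image[OF f] in \<open>auto intro!: measurable_component_singleton\<close>)
  have "measure ?U {A \<in> space ?U. middle b a c A} =
      measure (distr ?U ?U ?g) {A \<in> space ?U. middle b a c A}"
    by (simp only: distr_uniform_array_permute[OF f])
  also have "\<dots> = measure ?U (?g -` {A \<in> space ?U. middle b a c A} \<inter> space ?U)"
    by (rule measure_distr[OF g middle_in_sets[OF abc]])
  also have "?g -` {A \<in> space ?U. middle b a c A} \<inter> space ?U =
      {A \<in> space ?U. middle (f b) (f a) (f c) A}"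
    using measurable_space[OF g] abc by (auto simp: middle_def)
  finally show ?thesis by simp
qed

text \<open>Almost surely exactly one of the three entries is the median, and transpositions show
  that the three cases are equally likely.\<close>

lemma measure_middle:
  assumes abc: "a \<in> {1..n}" "b \<in> {1..n}" "c \<in> {1..n}" "a \<noteq> b" "a \<noteq> c" "b \<noteq> c"
  shows "measure (uniform_array n) {A \<in> space (uniform_array n). middle b a c A} = 1 / 3"
proof -
  let ?U = "uniform_array n"
  interpret prob_space ?U by (rule prob_space_uniform_array)
  let ?P = "\<lambda>b a c. {A \<in> space ?U. middle b a c A}"
  have 1: "prob (?P a b c) = prob (?P b a c)"
    using measure_middle_permute[of "Transposition.transpose a b" n a b c] abc
    by (simp add: permutes_swap_id transpose_apply_other)
  have 2: "prob (?P c a b) = prob (?P b a c)"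
    using measure_middle_permute[of "Transposition.transpose c b" n a b c] abc
    by (simp add: permutes_swap_id transpose_apply_other)
  have "AE A in ?U. A a \<noteq> A b \<and> A a \<noteq> A c \<and> A b \<noteq> A c"
    using AE_uniform_array_neq abc by (auto intro!: AE_conjI)
  then have "AE A in ?U. indicator (?P b a c) A + indicator (?P a b c) A + indicator (?P c a b) A = (1::real)"
    using AE_space by eventually_elim (auto simp: middle_def indicator_def)
  then have "(\<integral>A. indicator (?P b a c) A + indicator (?P a b c) A + indicator (?P c a b) A \<partial>?U)
      = (\<integral>A. (1::real) \<partial>?U)"
    by (intro integral_cong_AE) (use abc in measurable)
  moreover have "(\<integral>A. indicator (?P b a c) A + indicator (?P a b c) A + indicator (?P c a b) A \<partial>?U)
      = prob (?P b a c) + prob (?P a b c) + prob (?P c a b)"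
  proof -
    have m: "?P b a c \<in> sets ?U" "?P a b c \<in> sets ?U" "?P c a b \<in> sets ?U"
      using abc by (simp_all add: middle_in_sets)
    then have "integrable ?U (indicator (?P b a c) :: _ \<Rightarrow> real)"
      "integrable ?U (indicator (?P a b c) :: _ \<Rightarrow> real)"
      "integrable ?U (indicator (?P c a b) :: _ \<Rightarrow> real)"
      by (simp_all add: less_top[symmetric])
    then show ?thesis by (simp add: m sets.Int_space_eq2)
  qed
  ultimately show ?thesis using 1 2 by (simp add: prob_space)
qed

subsection \<open>The encoding\<close>

definition rmq_code :: "nat \<Rightarrow> (nat \<Rightarrow> real) \<Rightarrow> bool list" where
  "rmq_code n A = encode n (postorder (cartesian_tree n A))"

lemma size_cartesian_tree: "size (cartesian_tree n A) = n"
  by (simp add: cartesian_tree_def size_cartesian_seg)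

text \<open>Of the \<open>8 * L\<close> bits, \<open>L\<close> hold \<open>n + 2\<close> and the
  other \<open>7 * L\<close> provide a factor of at least 128, since \<open>L\<close> is positive.
  Having 128 instead of 64 makes the inequality strict.\<close>

lemma word_size_bound: "64 * (n + 2) < 2 ^ word_size 8 n"
proof -
  define L where "L = nat \<lceil>log 2 (real n + 2)\<rceil>"
  have "log 2 (real n + 2) \<le> real L" by (simp add: L_def real_nat_ceiling_ge)
  then have "real n + 2 \<le> 2 ^ L"
    by (simp add: log_le_iff powr_realpow)
  then have "real (n + 2) \<le> real (2 ^ L)" by simp
  then have L: "n + 2 \<le> 2 ^ L" by (simp only: of_nat_le_iff)
  have "L \<noteq> 0"
    using L by (intro notI) simp
  then have "(2::nat) ^ 7 \<le> 2 ^ (7 * L)" by (intro power_increasing) auto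
  then have "2 ^ 7 * (n + 2) \<le> 2 ^ (7 * L) * 2 ^ L" using L by (intro mult_mono) auto
  also have "\<dots> = 2 ^ word_size 8 n" by (simp add: word_size_def L_def flip: power_add)
  finally show ?thesis by simp
qed

lemma decoder_rmq_code:
  "let w = word_size 8 n; s = (step w (rmq_code n A) decoder ^^ (100 * (n + 1)))
        (init_state w n (rmq_code n A))
   in halted decoder s \<and> stores_tree (mem s) (reg s 0) (cartesian_tree n A)"
proof -
  interpret decoder_run n "word_size 8 n" "rmq_code n A"
    by unfold_locales
      (use word_size_bound in \<open>simp_all add: rmq_code_def encode_length_le length_postorder size_cartesian_tree\<close>)
  show ?thesis
    using decoder_correct[of "cartesian_tree n A"] by (simp add: size_cartesian_tree rmq_code_def Let_def)
qed

lemma linear_time_decodable_rmq_code: "linear_time_decodable rmq_code"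
  unfolding linear_time_decodable_def
proof (intro exI conjI allI ballI)
  show "(\<lambda>n. real (100 * (n + 1))) \<in> O(\<lambda>n. real n)" by real_asymp
qed (rule decoder_rmq_code)

lemma linked_tree_unique: "linked_tree M p t \<Longrightarrow> linked_tree M p t' \<Longrightarrow> t = t'"
proof (induction t arbitrary: p t')
  case Leaf
  then show ?case by (cases t') auto
next
  case (Node l u r)
  then show ?case by (cases t') auto
qed

text \<open>Injectivity comes for free from the decoder: equal codes give the same run, and the
  final memory represents only one tree at a given address.\<close>

lemma rmq_code_determines_tree:
  assumes "rmq_code n A = rmq_code n B"
  shows "cartesian_tree n A = cartesian_tree n B"
  using decoder_rmq_code[of n A] decoder_rmq_code[of n B] assms
  by (auto simp: Let_def stores_tree_def intro: linked_tree_unique)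

text \<open>A query is answered on an arbitrarily chosen array of distinct entries with the given
  code. Its Cartesian tree is that of the original array, hence so are its range maxima.\<close>

lemma rmq_encoding_rmq_code: "rmq_encoding rmq_code"
  unfolding rmq_encoding_def
proof (intro exI allI ballI impI)
  let ?B = "\<lambda>n bs. SOME B. B \<in> distinct_arrays n \<and> rmq_code n B = bs"
  fix n A i j
  assume A: "A \<in> distinct_arrays n" and ij: "1 \<le> i \<and> i \<le> j \<and> j \<le> n"
  define B where "B = ?B n (rmq_code n A)"
  have B: "B \<in> distinct_arrays n" "rmq_code n B = rmq_code n A"
    using someI[of "\<lambda>B. B \<in> distinct_arrays n \<and> rmq_code n B = rmq_code n A" A] A
    by (simp_all add: B_def)
  have "{1..<n + 1} = {1..n}" by auto
  then have "rmq B i j = rmq A i j"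
    unfolding rmq_def
    using range_max_from_cartesian_seg[of B 1 "n + 1" A i j] rmq_code_determines_tree[OF B(2)] A B ij
    by (simp add: cartesian_tree_def distinct_arrays_def)
  then show "(\<lambda>n bs. rmq (?B n bs)) n (rmq_code n A) i j = rmq A i j"
    by (simp only: B_def)
qed

section \<open>Measurability and expected length\<close>

lemma measurable_cartesian_tree:
  "cartesian_tree n \<in> measurable (uniform_array n) (count_space UNIV)"
proof -
  let ?U = "uniform_array n" and ?I = "{1..n}"
  \<comment> \<open>The tree factors through the set of comparisons that hold, which takes finitely
    many values, each on a measurable set.\<close>
  define R :: "(nat \<Rightarrow> real) \<Rightarrow> (nat \<times> nat) set" where
    "R A = {p \<in> ?I \<times> ?I. A (fst p) < A (snd p)}" for A
  have sub: "R A \<subseteq> ?I \<times> ?I" for A by (auto simp: R_def)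
  have "R -` {r} \<inter> space ?U \<in> sets ?U" if r: "r \<subseteq> ?I \<times> ?I" for r
  proof -
    have eq: "R A = r \<longleftrightarrow> (\<forall>p\<in>?I \<times> ?I. A (fst p) < A (snd p) \<longleftrightarrow> p \<in> r)" for A
      using r unfolding R_def by blast
    have "{A \<in> space ?U. A (fst p) < A (snd p) \<longleftrightarrow> p \<in> r} \<in> sets ?U" if "p \<in> ?I \<times> ?I" for p
    proof -
      have "{A \<in> space ?U. A (fst p) < A (snd p)} \<in> sets ?U"
        by (rule less_in_sets_uniform_array) (use that in auto)
      then show ?thesis by (cases "p \<in> r") (simp_all add: sets.sets_Collect_neg)
    qed
    then have "{A \<in> space ?U. \<forall>p\<in>?I \<times> ?I. A (fst p) < A (snd p) \<longleftrightarrow> p \<in> r} \<in> sets ?U"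
      by (rule sets.sets_Collect_finite_All) simp_all
    moreover have "R -` {r} \<inter> space ?U =
        {A \<in> space ?U. \<forall>p\<in>?I \<times> ?I. A (fst p) < A (snd p) \<longleftrightarrow> p \<in> r}"
      by (simp only: vimage_def singleton_iff eq Int_def mem_Collect_eq conj_commute)
    ultimately show ?thesis by simp
  qed
  then have R: "R \<in> measurable ?U (count_space (Pow (?I \<times> ?I)))"
    using sub by (subst measurable_count_space_eq2) auto
  have "cartesian_tree n A = cartesian_tree n B" if "R A = R B" for A B
    unfolding cartesian_tree_def
  proof (rule cartesian_seg_cong)
    fix a b assume ab: "a \<in> {1..<n + 1}" "b \<in> {1..<n + 1}"
    from that have "(a, b) \<in> R A \<longleftrightarrow> (a, b) \<in> R B" by simp
    with ab show "A a < A b \<longleftrightarrow> B a < B b" by (simp add: R_def)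
  qed
  \<comment> \<open>Choosing a representative array for each comparison pattern exhibits the tree as
    a function of \<open>R\<close>.\<close>
  then have "cartesian_tree n A = cartesian_tree n (SOME B. R B = R A)" for A
    by (metis (mono_tags, lifting) someI)
  then have "cartesian_tree n = (\<lambda>r. cartesian_tree n (SOME B. R B = r)) \<circ> R"
    by (simp add: fun_eq_iff)
  also have "\<dots> \<in> measurable ?U (count_space UNIV)"
    using R by (rule measurable_comp) simp
  finally show ?thesis .
qed

lemma measurable_of_cartesian_tree:
  fixes f :: "unit tree \<Rightarrow> real"
  shows "(\<lambda>A. f (cartesian_tree n A)) \<in> borel_measurable (uniform_array n)"
  by (rule measurable_compose[OF measurable_cartesian_tree]) simp

lemma integrable_of_cartesian_tree:
  fixes f :: "unit tree \<Rightarrow> real"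
  assumes "\<And>A. \<bar>f (cartesian_tree n A)\<bar> \<le> C"
  shows "integrable (uniform_array n) (\<lambda>A. f (cartesian_tree n A))"
proof -
  interpret prob_space "uniform_array n" by (rule prob_space_uniform_array)
  show ?thesis
    by (rule integrable_const_bound[of _ C]) (use assms measurable_of_cartesian_tree in auto)
qed

abbreviation unary_count :: "nat \<Rightarrow> (nat \<Rightarrow> real) \<Rightarrow> real" where
  "unary_count n A \<equiv> real (length (filter unary (postorder (cartesian_tree n A))))"

lemma unary_count_le: "unary_count n A \<le> real n"
  using length_filter_le[of unary "postorder (cartesian_tree n A)"]
  by (simp add: length_postorder size_cartesian_tree)

lemma integrable_unary_count: "integrable (uniform_array n) (unary_count n)"
  by (rule integrable_of_cartesian_tree[of _ _ "real n"]) (use unary_count_le in auto)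

text \<open>Each of the \<open>n - 2\<close> inner positions contributes \<open>1 / 3\<close>, and
  the two ends together contribute between 0 and 2. Arrays with at most one entry have no two
  separate ends and are treated directly.\<close>

lemma expectation_unary_count:
  "\<bar>(\<integral>A. unary_count n A \<partial>uniform_array n) - real n / 3\<bar> \<le> 2"
proof (cases "n \<le> 1")
  case True
  interpret prob_space "uniform_array n" by (rule prob_space_uniform_array)
  have "(\<integral>A. unary_count n A \<partial>uniform_array n) \<le> real n"
    by (rule integral_le_const[OF integrable_unary_count]) (use unary_count_le in auto)
  moreover have "0 \<le> (\<integral>A. unary_count n A \<partial>uniform_array n)" by simp
  ultimately show ?thesis using True unfolding abs_le_iff by linarith
next
  case False
  let ?U = "uniform_array n"
  interpret prob_space ?U by (rule prob_space_uniform_array)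
  let ?S = "\<lambda>A. \<Sum>k = 2..<n. indicator {A \<in> space ?U. middle k (k - 1) (k + 1) A} A :: real"
  have S: "AE A in ?U. ?S A \<le> unary_count n A \<and> unary_count n A \<le> ?S A + 2"
    using AE_uniform_array_inj AE_space
  proof eventually_elim
    case (elim A)
    have eq: "{1..<n + 1} = {1..n}" by auto
    let ?f = "\<lambda>k. of_bool (one_sided A 1 (n + 1) k) :: real"
    have "unary_count n A = real (\<Sum>k = 1..<n + 1. of_bool (one_sided A 1 (n + 1) k))"
      using count_unary_cartesian_seg[of A 1 "n + 1"] elim(1) unfolding cartesian_tree_def eq
      by (simp only:)
    also have "\<dots> = (\<Sum>k = 1..<n + 1. ?f k)" by simp
    also have "{1..<n + 1} = insert 1 (insert n {2..<n})" using False by auto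
    also have "(\<Sum>k \<in> insert 1 (insert n {2..<n}). ?f k) = ?f 1 + (?f n + (\<Sum>k = 2..<n. ?f k))"
      using False by simp
    also have "(\<Sum>k = 2..<n. ?f k) = ?S A"
    proof (rule sum.cong)
      fix k assume "k \<in> {2..<n}"
      then show "?f k = indicator {A \<in> space ?U. middle k (k - 1) (k + 1) A} A"
        using elim(2) by (auto simp: one_sided_def middle_def indicator_def)
    qed simp
    finally have "unary_count n A = ?f 1 + (?f n + ?S A)" .
    moreover have "0 \<le> ?f k \<and> ?f k \<le> 1" for k by simp
    ultimately show ?case by (smt (verit))
  qed
  have m: "{A \<in> space ?U. middle k (k - 1) (k + 1) A} \<in> sets ?U" if "k \<in> {2..<n}" for k
    using that by (intro middle_in_sets) auto
  then have int: "integrable ?U ?S"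
    by (intro Bochner_Integration.integrable_sum integrable_real_indicator)
      (auto simp: less_top[symmetric])
  have "(\<integral>A. ?S A \<partial>?U) = (\<Sum>k = 2..<n. prob {A \<in> space ?U. middle k (k - 1) (k + 1) A})"
    using m by (subst Bochner_Integration.integral_sum) (auto intro!: integrable_real_indicator sum.cong simp: less_top[symmetric])
  also have "\<dots> = (\<Sum>k = 2..<n. 1 / 3)"
    by (intro sum.cong measure_middle) auto
  finally have ES: "(\<integral>A. ?S A \<partial>?U) = (real n - 2) / 3" using False by (simp add: of_nat_diff)
  have "(\<integral>A. ?S A \<partial>?U) \<le> (\<integral>A. unary_count n A \<partial>?U)"
    by (rule integral_mono_AE[OF int integrable_unary_count]) (use S in auto)
  moreover have "(\<integral>A. unary_count n A \<partial>?U) \<le> (\<integral>A. ?S A + 2 \<partial>?U)"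
    by (rule integral_mono_AE[OF integrable_unary_count]) (use int S in auto)
  moreover have "(\<integral>A. ?S A + 2 \<partial>?U) = (\<integral>A. ?S A \<partial>?U) + 2"
    using int by (simp add: prob_space)
  ultimately show ?thesis unfolding ES by (simp add: abs_le_iff field_simps)
qed

lemma integrable_length_rmq_code:
  "integrable (uniform_array n) (\<lambda>A. real (length (rmq_code n A)))"
  unfolding rmq_code_def
proof (rule integrable_of_cartesian_tree)
  show "\<bar>real (length (encode n (postorder (cartesian_tree n A))))\<bar> \<le> real (6 * n + 6)" for A
    using encode_length_le[of "postorder (cartesian_tree n A)" n]
    by (simp add: length_postorder size_cartesian_tree del: of_nat_add of_nat_mult)
qed

lemma rmq_const_eq: "rmq_const = log 2 3 + 1 / 3"
proof -
  have "log 2 (2 * 3) = log 2 2 + log 2 (3::real)" by (rule log_mult_pos) auto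
  then show ?thesis by (simp add: rmq_const_def add_divide_distrib)
qed

text \<open>The constant 5 joins the 3 of the deterministic length estimate to the 2 lost in the
  expected number of one-child nodes.\<close>

lemma expectation_length_rmq_code:
  "\<bar>(\<integral>A. real (length (rmq_code n A)) \<partial>uniform_array n) - rmq_const * real n\<bar>
    \<le> 5 + log 2 (3 * real n + 3)"
proof -
  let ?U = "uniform_array n"
  interpret prob_space ?U by (rule prob_space_uniform_array)
  define D where "D = 3 + log 2 (3 * real n + 3)"
  let ?g = "\<lambda>A. real (length (rmq_code n A)) - real n * log 2 3 - unary_count n A"
  have g: "\<bar>?g A\<bar> \<le> D" for A
    using encode_length[of "postorder (cartesian_tree n A)" n]
    by (simp add: rmq_code_def D_def length_postorder size_cartesian_tree)
  note int = integrable_length_rmq_code[of n] integrable_unary_count[of n]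
  have "\<bar>\<integral>A. ?g A \<partial>?U\<bar> \<le> (\<integral>A. \<bar>?g A\<bar> \<partial>?U)" by (rule integral_abs_bound)
  also have "\<dots> \<le> (\<integral>A. D \<partial>?U)"
    by (rule integral_mono) (use int g in auto)
  finally have "\<bar>\<integral>A. ?g A \<partial>?U\<bar> \<le> D" by (simp add: prob_space)
  moreover have "(\<integral>A. ?g A \<partial>?U) = (\<integral>A. real (length (rmq_code n A)) \<partial>?U) - real n * log 2 3
      - (\<integral>A. unary_count n A \<partial>?U)"
    using int by (simp add: prob_space)
  ultimately show ?thesis
    using expectation_unary_count[of n] by (simp add: rmq_const_eq D_def algebra_simps)
qed

text \<open>The integer comparisons \<open>2 ^ 569 < 3 ^ 359\<close> and
  \<open>3 ^ 200 < 2 ^ 317\<close> place the logarithm between 1.58495 and 1.585. After adding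
  \<open>1 / 3\<close> this is precise enough for the four decimals claimed.\<close>

lemma log_2_3_bounds: "569 / 359 < log 2 (3::real)" "log 2 (3::real) < 317 / 200"
proof -
  have pow: "log 2 (3 ^ 359) = real 359 * log 2 (3::real)" "log 2 (2 ^ 569) = real 569 * log 2 (2::real)"
    "log 2 (3 ^ 200) = real 200 * log 2 (3::real)" "log 2 (2 ^ 317) = real 317 * log 2 (2::real)"
    by (rule log_nat_power, simp)+
  have "log 2 (2 ^ 569) < log 2 (3 ^ 359 :: real)" by (subst log_less_cancel_iff) simp_all
  then show "569 / 359 < log 2 (3::real)" unfolding pow by simp
  have "log 2 (3 ^ 200) < log 2 (2 ^ 317 :: real)" by (subst log_less_cancel_iff) simp_all
  then show "log 2 (3::real) < 317 / 200" unfolding pow by simp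
qed

theorem theorem2:
  shows "(\<exists>enc :: nat \<Rightarrow> (nat \<Rightarrow> real) \<Rightarrow> bool list.
            rmq_encoding enc \<and>
            linear_time_decodable enc \<and>
            (\<forall>n. integrable (uniform_array n) (\<lambda>A. real (length (enc n A)))) \<and>
            (\<lambda>n. (\<integral>A. real (length (enc n A)) \<partial>uniform_array n) - rmq_const * real n)
              \<in> o(\<lambda>n. real n)) \<and>
         \<bar>rmq_const - 1.9183\<bar> < 0.00005 \<and>
         rmq_const < 1.92"
proof (intro conjI exI[of _ rmq_code])
  have "(\<lambda>n. (\<integral>A. real (length (rmq_code n A)) \<partial>uniform_array n) - rmq_const * real n)
      \<in> O(\<lambda>n. 5 + log 2 (3 * real n + 3))"
  proof (rule bigoI[of _ 1], rule always_eventually, rule allI)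
    fix n :: nat
    show "norm ((\<integral>A. real (length (rmq_code n A)) \<partial>uniform_array n) - rmq_const * real n)
        \<le> 1 * norm (5 + log 2 (3 * real n + 3))"
      using expectation_length_rmq_code[of n] by simp
  qed
  also have "(\<lambda>n. 5 + log 2 (3 * real n + 3)) \<in> o(\<lambda>n. real n)" by real_asymp
  finally show "(\<lambda>n. (\<integral>A. real (length (rmq_code n A)) \<partial>uniform_array n) - rmq_const * real n)
      \<in> o(\<lambda>n. real n)" .
  show "\<bar>rmq_const - 1.9183\<bar> < 0.00005" "rmq_const < 1.92"
    using log_2_3_bounds unfolding rmq_const_eq abs_less_iff by (simp_all add: field_simps)
qed (use rmq_encoding_rmq_code linear_time_decodable_rmq_code integrable_length_rmq_code in auto)

end
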